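(* Let $n\geq 2$ be even and let $P_n$ be the path with vertices $0,1,\dots,n$ and edges $\{i,i+1\}$ for $0\le i<n$. Then, among all $r\in\{0,\dots,n\}$, the cover cost $cc_r(P_n)$ is minimised when $r$ is an endpoint ($r=0$ or $r=n$) and maximised when $r=n/2$. Moreover, $cc_{n/2}(P_n)-cc_0(P_n)=n/4$.
   Context: Simple random walk on a graph $G=(V,E)$: at each step the walker moves from its current vertex to a uniformly random neighbour. Cover cost: run simple random walk from $r$ until every vertex has been visited. For $i\geq 1$, the cost of the $i$-th step is $1-\frac{k}{n}$, where $k$ is the number of distinct vertices other than $r$ visited at times $0,1,\dots,i-1$, and $n=|V|-1$. The cover cost $cc_r(G)$ is the expected total cost of all steps of this cover tour. *)

theory Defs
  imports "HOL-Probability.Probability"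
begin

text \<open>A simple graph is given by its vertex set \<open>V\<close> and its set \<open>E\<close> of two-element edges.\<close>

definition neighbours :: "'a set \<Rightarrow> 'a set set \<Rightarrow> 'a \<Rightarrow> 'a set" where
  "neighbours V E v = {w \<in> V. {v, w} \<in> E}"

text \<open>Law of the walker's position at time \<open>i\<close>, given the trajectory \<open>\<omega>\<close> at the times below \<open>i\<close>.
  The uniform choice is meaningful when the current vertex has a finite, nonempty set of neighbours.\<close>

definition walk_kernel ::
  "'a set \<Rightarrow> 'a set set \<Rightarrow> 'a \<Rightarrow> nat \<Rightarrow> (nat \<Rightarrow> 'a) \<Rightarrow> 'a measure" where
  "walk_kernel V E r i \<omega> = measure_pmf
     (case i of 0 \<Rightarrow> return_pmf r | Suc j \<Rightarrow> pmf_of_set (neighbours V E (\<omega> j)))"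

lemma Ionescu_Tulcea_walk_kernel:
  "Ionescu_Tulcea (walk_kernel V E r) (\<lambda>_. count_space UNIV)"
proof (rule Ionescu_Tulcea.intro)
  fix i
  show "walk_kernel V E r i
      \<in> PiM {0..<i} (\<lambda>_. count_space UNIV) \<rightarrow>\<^sub>M subprob_algebra (count_space UNIV)"
  proof (cases i)
    case 0
    then show ?thesis
      by (simp add: walk_kernel_def[abs_def] measure_pmf_in_subprob_algebra)
  next
    case (Suc j)
    have "(\<lambda>\<omega>. \<omega> j) \<in> PiM {0..<i} (\<lambda>_. count_space UNIV) \<rightarrow>\<^sub>M (count_space UNIV :: 'a measure)"
      using Suc by (intro measurable_component_singleton) simp
    moreover have "(\<lambda>v. measure_pmf (pmf_of_set (neighbours V E v)))
        \<in> count_space UNIV \<rightarrow>\<^sub>M subprob_algebra (count_space UNIV)"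
      by (simp add: measure_pmf_in_subprob_algebra)
    ultimately have "(\<lambda>\<omega>. measure_pmf (pmf_of_set (neighbours V E (\<omega> j))))
        \<in> PiM {0..<i} (\<lambda>_. count_space UNIV) \<rightarrow>\<^sub>M subprob_algebra (count_space UNIV)"
      by (rule measurable_compose)
    then show ?thesis
      using Suc by (simp add: walk_kernel_def[abs_def])
  qed
qed (simp add: walk_kernel_def prob_space_measure_pmf)

text \<open>Law of the whole trajectory of simple random walk started at \<open>r\<close>: the measure on
  \<open>nat \<Rightarrow> 'a\<close> that the Ionescu-Tulcea theorem provides for the kernels above. The long name is
  the constant \<open>PF.lim\<close> of locale \<open>Ionescu_Tulcea\<close>, whose assumptions hold by
  \<open>Ionescu_Tulcea_walk_kernel\<close>.\<close>

definition simple_random_walk :: "'a set \<Rightarrow> 'a set set \<Rightarrow> 'a \<Rightarrow> (nat \<Rightarrow> 'a) measure" where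
  "simple_random_walk V E r =
     projective_family.lim UNIV
       (Ionescu_Tulcea.CI (walk_kernel V E r) (\<lambda>_. count_space UNIV)) (\<lambda>_. count_space UNIV)"

text \<open>First time by which every vertex has been visited; \<open>\<infinity>\<close> if there is none.\<close>

definition cover_time :: "'a set \<Rightarrow> (nat \<Rightarrow> 'a) \<Rightarrow> enat" where
  "cover_time V \<omega> = (INF t\<in>{t. V \<subseteq> \<omega> ` {..t}}. enat t)"

text \<open>Step \<open>i \<ge> 1\<close> leads from \<open>\<omega> (i - 1)\<close> to \<open>\<omega> i\<close>.\<close>

definition step_cost :: "'a set \<Rightarrow> 'a \<Rightarrow> (nat \<Rightarrow> 'a) \<Rightarrow> nat \<Rightarrow> real" where
  "step_cost V r \<omega> i = 1 - real (card (\<omega> ` {..<i} - {r})) / (real (card V) - 1)"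

definition tour_cost :: "'a set \<Rightarrow> 'a \<Rightarrow> (nat \<Rightarrow> 'a) \<Rightarrow> ennreal" where
  "tour_cost V r \<omega> =
     (\<Sum>i. if 1 \<le> i \<and> enat i \<le> cover_time V \<omega> then ennreal (step_cost V r \<omega> i) else 0)"

definition cover_cost :: "'a set \<Rightarrow> 'a set set \<Rightarrow> 'a \<Rightarrow> ennreal" where
  "cover_cost V E r = (\<integral>\<^sup>+\<omega>. tour_cost V r \<omega> \<partial>simple_random_walk V E r)"

definition path_vertices :: "nat \<Rightarrow> nat set" where
  "path_vertices n = {0..n}"

definition path_edges :: "nat \<Rightarrow> nat set set" where
  "path_edges n = {{i, i + 1} | i. i < n}"

end

theory Submission
  imports Defs
begin

text \<open>At each step the cost is \<open>1/n\<close> times the number of unvisited vertices, so the cover cost is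
  \<open>1/n\<close> times the sum over \<open>v\<close> of the expected hitting times of \<open>v\<close> from \<open>r\<close>. A function \<open>h\<close> that
  vanishes at \<open>v\<close> and exceeds its neighbour average by \<open>1\<close> elsewhere is this hitting time: the
  expectation of \<open>h\<close> at the current position, restricted to not having hit \<open>v\<close>, drops at each
  step by the probability of not having hit \<open>v\<close>, and it tends to \<open>0\<close>. On the path,
  \<open>h x = v\<^sup>2 - x\<^sup>2\<close> for \<open>x \<le> v\<close>, and symmetrically for \<open>x > v\<close>; the resulting cover cost is
  \<open>(n + 1)(2n + 1)/6 + r(n - r)/n\<close>.\<close>

section \<open>Finite-time marginals of the Ionescu-Tulcea limit\<close>

text \<open>\<open>CI J\<close> is the finite-time law \<open>C 0 (up_to J)\<close> restricted to
  \<open>J\<close>; on an initial segment \<open>up_to\<close> returns the length of that segment,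
  so the restriction changes nothing. The start \<open>\<lambda>_. undefined\<close> is the empty
  trajectory.\<close>

lemma (in Ionescu_Tulcea) distr_lim_atLeastLessThan:
  "distr PF.lim (PiM {0..<k} M) (\<lambda>\<omega>. restrict \<omega> {0..<k}) = C 0 k (\<lambda>_. undefined)"
proof -
  have k: "up_to {0..<k} = k"
  proof (rule antisym)
    show "up_to {0..<k} \<le> k" by (simp add: up_to_iff)
    show "k \<le> up_to {0..<k}" using up_to_less[of "{0..<k}" "k - 1"] by (cases k) auto
  qed
  have "distr PF.lim (PiM {0..<k} M) (\<lambda>\<omega>. restrict \<omega> {0..<k}) = CI {0..<k}"
    by (rule distr_lim) simp
  also have "\<dots> = C 0 k (\<lambda>_. undefined)"
    using distr_C[of k k "\<lambda>_. undefined" 0] by (simp add: CI_def k)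
  finally show ?thesis .
qed

lemma (in Ionescu_Tulcea) nn_integral_lim_restrict:
  assumes [measurable]: "f \<in> borel_measurable (PiM {0..<k} M)"
  shows "(\<integral>\<^sup>+\<omega>. f (restrict \<omega> {0..<k}) \<partial>PF.lim) = (\<integral>\<^sup>+\<omega>. f \<omega> \<partial>C 0 k (\<lambda>_. undefined))"
proof -
  have [measurable]: "(\<lambda>\<omega>. restrict \<omega> {0..<k}) \<in> PF.lim \<rightarrow>\<^sub>M PiM {0..<k} M"
    by (simp add: measurable_cong_sets[OF PF.sets_lim refl] measurable_restrict_subset)
  show ?thesis
    unfolding distr_lim_atLeastLessThan[symmetric] by (subst nn_integral_distr) simp_all
qed

text \<open>The law of \<open>Suc k\<close> coordinates is the law of the first \<open>k\<close>
  bound to \<open>eP k\<close>, so the last coordinate can be integrated out first, given the past.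
  The Markov property of the walk rests on this.\<close>

lemma (in Ionescu_Tulcea) nn_integral_lim_Suc:
  assumes f: "f \<in> borel_measurable (PiM {0..<Suc k} M)"
  shows "(\<integral>\<^sup>+\<omega>. f (restrict \<omega> {0..<Suc k}) \<partial>PF.lim) =
    (\<integral>\<^sup>+\<omega>. (\<integral>\<^sup>+x. f ((restrict \<omega> {0..<k})(k := x)) \<partial>P k (restrict \<omega> {0..<k})) \<partial>PF.lim)"
proof -
  let ?u = "\<lambda>_::nat. undefined :: 'a"
  note [measurable] = f
  have [measurable]: "(\<lambda>\<omega>. \<integral>\<^sup>+x. f x \<partial>eP k \<omega>) \<in> borel_measurable (PiM {0..<k} M)"
    by (rule measurable_compose[OF measurable_eP nn_integral_measurable_subprob_algebra[OF f]])
  have "(\<integral>\<^sup>+\<omega>. f (restrict \<omega> {0..<Suc k}) \<partial>PF.lim) = (\<integral>\<^sup>+\<omega>. f \<omega> \<partial>(C 0 k ?u \<bind> eP k))"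
    by (subst nn_integral_lim_restrict) simp_all
  also have "\<dots> = (\<integral>\<^sup>+\<omega>. (\<integral>\<^sup>+x. f x \<partial>eP k \<omega>) \<partial>C 0 k ?u)"
    by (rule nn_integral_bind[where B="PiM {0..<Suc k} M"])
       (simp_all add: measurable_cong_sets[OF sets_C refl])
  also have "\<dots> = (\<integral>\<^sup>+\<omega>. (\<integral>\<^sup>+x. f x \<partial>eP k (restrict \<omega> {0..<k})) \<partial>PF.lim)"
    by (subst nn_integral_lim_restrict) simp_all
  also have "\<dots> = (\<integral>\<^sup>+\<omega>. (\<integral>\<^sup>+x. f ((restrict \<omega> {0..<k})(k := x)) \<partial>P k (restrict \<omega> {0..<k})) \<partial>PF.lim)"
    by (rule nn_integral_cong, rule nn_integral_eP) (auto simp: space_PiM f)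
  finally show ?thesis .
qed

section \<open>The walk measure: start, one step, confinement to the vertex set\<close>

lemma measurable_coordinate_discrete:
  "j \<in> J \<Longrightarrow> range f \<subseteq> space N \<Longrightarrow>
    (\<lambda>\<omega>. f (\<omega> j)) \<in> PiM J (\<lambda>_. count_space UNIV) \<rightarrow>\<^sub>M N"
  by (rule measurable_compose[OF measurable_component_singleton]) auto

lemma sets_simple_random_walk [measurable_cong]:
  "sets (simple_random_walk V E r) = sets (PiM UNIV (\<lambda>_. count_space UNIV))"
proof -
  interpret Ionescu_Tulcea "walk_kernel V E r" "\<lambda>_. count_space UNIV"
    by (rule Ionescu_Tulcea_walk_kernel)
  show ?thesis by (simp add: simple_random_walk_def)
qed

lemma space_simple_random_walk [simp]: "space (simple_random_walk V E r) = UNIV"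
  using sets_eq_imp_space_eq[OF sets_simple_random_walk] by (simp add: space_PiM)

lemma prob_space_simple_random_walk: "prob_space (simple_random_walk V E r)"
proof -
  interpret Ionescu_Tulcea "walk_kernel V E r" "\<lambda>_. count_space UNIV"
    by (rule Ionescu_Tulcea_walk_kernel)
  show ?thesis
    unfolding simple_random_walk_def
    \<comment> \<open>A measure with a pushforward of mass 1 has mass 1 itself, so the projection to
      the empty index set \<open>{0..<0}\<close> suffices.\<close>
    by (rule prob_space_distrD[where f="\<lambda>\<omega>. restrict \<omega> {0..<0}" and N="PiM {0..<0} (\<lambda>_. count_space UNIV)"])
       (auto simp only: distr_lim_atLeastLessThan measurable_cong_sets[OF PF.sets_lim refl]
          intro!: prob_space_C measurable_restrict_subset, auto)
qed

lemma nn_integral_walk_start: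
  "(\<integral>\<^sup>+\<omega>. f (\<omega> 0) \<partial>simple_random_walk V E r) = f r"
proof -
  interpret Ionescu_Tulcea "walk_kernel V E r" "\<lambda>_. count_space UNIV"
    by (rule Ionescu_Tulcea_walk_kernel)
  interpret W: prob_space "simple_random_walk V E r" by (rule prob_space_simple_random_walk)
  have "(\<lambda>\<omega>. f (\<omega> 0)) \<in> borel_measurable (PiM {0..<Suc 0} (\<lambda>_. count_space UNIV))"
    by (rule measurable_coordinate_discrete) auto
  from nn_integral_lim_Suc[OF this] W.emeasure_space_1 show ?thesis
    by (simp add: walk_kernel_def nn_integral_return flip: simple_random_walk_def)
qed

text \<open>The event depends only on times up to \<open>i\<close>, so it factors out of the
  integral over the next position. The case \<open>S = V\<close> confines the walk to
  \<open>V\<close>; the case \<open>S = V - {v}\<close> gives the walk killed at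
  \<open>v\<close>.\<close>

lemma nn_integral_walk_step:
  fixes f :: "'a \<Rightarrow> ennreal" and S :: "'a set"
  shows "(\<integral>\<^sup>+\<omega>. f (\<omega> (Suc i)) * indicator {\<omega>. \<forall>j\<le>i. \<omega> j \<in> S} \<omega> \<partial>simple_random_walk V E r) =
    (\<integral>\<^sup>+\<omega>. (\<integral>\<^sup>+x. f x \<partial>pmf_of_set (neighbours V E (\<omega> i))) * indicator {\<omega>. \<forall>j\<le>i. \<omega> j \<in> S} \<omega>
      \<partial>simple_random_walk V E r)"
proof -
  interpret Ionescu_Tulcea "walk_kernel V E r" "\<lambda>_. count_space UNIV"
    by (rule Ionescu_Tulcea_walk_kernel)
  let ?g = "\<lambda>\<omega>. f (\<omega> (Suc i)) * (if \<forall>j\<in>{0..i}. \<omega> j \<in> S then 1 else 0)"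
  have [measurable]: "(\<lambda>\<omega>. f (\<omega> (Suc i))) \<in> borel_measurable (PiM {0..<Suc (Suc i)} (\<lambda>_. count_space UNIV))"
    "\<And>j. j \<in> {0..i} \<Longrightarrow> Measurable.pred (PiM {0..<Suc (Suc i)} (\<lambda>_. count_space UNIV)) (\<lambda>\<omega>. \<omega> j \<in> S)"
    by (rule measurable_coordinate_discrete; simp)+
  have "?g \<in> borel_measurable (PiM {0..<Suc (Suc i)} (\<lambda>_. count_space UNIV))"
    by measurable
  from nn_integral_lim_Suc[OF this] show ?thesis
    by (simp add: walk_kernel_def indicator_def of_bool_def nn_integral_multc Ball_def flip: simple_random_walk_def)
qed

lemma measurable_walk_coordinate:
  "range f \<subseteq> space N \<Longrightarrow> (\<lambda>\<omega>. f (\<omega> j)) \<in> simple_random_walk V E r \<rightarrow>\<^sub>M N"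
  by (simp add: measurable_cong_sets[OF sets_simple_random_walk refl] measurable_coordinate_discrete)

lemma sets_walk_stays:
  "{\<omega>. \<forall>j\<le>i. \<omega> j \<in> S} \<in> sets (simple_random_walk V E r)"
proof -
  have [measurable]: "Measurable.pred (simple_random_walk V E r) (\<lambda>\<omega>. \<omega> j \<in> S)" for j
    by (rule measurable_walk_coordinate) simp
  have "{\<omega> \<in> space (simple_random_walk V E r). \<forall>j\<in>{..i}. \<omega> j \<in> S} \<in> sets (simple_random_walk V E r)"
    by measurable
  then show ?thesis by (simp add: Ball_def)
qed

lemma AE_walk_start: "AE \<omega> in simple_random_walk V E r. \<omega> 0 = r"
proof -
  have "(\<integral>\<^sup>+\<omega>. indicator (- {r}) (\<omega> 0) \<partial>simple_random_walk V E r) = 0"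
    by (subst nn_integral_walk_start) simp
  then have "AE \<omega> in simple_random_walk V E r. indicator (- {r}) (\<omega> 0) = (0::ennreal)"
    by (subst (asm) nn_integral_0_iff_AE) (auto intro: measurable_walk_coordinate)
  then show ?thesis
    by eventually_elim (auto simp: indicator_def split: if_splits)
qed

text \<open>A uniform choice from a finite nonempty set of neighbours stays in \<open>V\<close>, so
  at each time leaving \<open>V\<close> is a null event, and countably many null events have a null
  union. The hypotheses on \<open>V\<close> keep \<open>pmf_of_set\<close> away from arguments where
  it is unspecified.\<close>

lemma AE_walk_in:
  fixes V :: "'a set"
  assumes V: "finite V" "\<And>x. x \<in> V \<Longrightarrow> neighbours V E x \<noteq> {}" and r: "r \<in> V"
  shows "AE \<omega> in simple_random_walk V E r. \<omega> 0 = r \<and> range \<omega> \<subseteq> V"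
proof -
  let ?W = "simple_random_walk V E r"
  have "AE \<omega> in ?W. \<forall>j\<le>i. \<omega> j \<in> V" for i
  proof (induction i)
    case 0
    then show ?case using AE_walk_start by eventually_elim (simp add: r)
  next
    case (Suc i)
    have *: "(\<integral>\<^sup>+x. indicator (- V) x \<partial>pmf_of_set (neighbours V E y)) = 0" if "y \<in> V" for y
    proof -
      have N: "neighbours V E y \<subseteq> V" by (auto simp: neighbours_def)
      then have "finite (neighbours V E y)" using V(1) by (rule finite_subset)
      with V(2)[OF that] N show ?thesis
        by (subst nn_integral_pmf_of_set) (auto intro!: sum.neutral)
    qed
    have "(\<integral>\<^sup>+\<omega>. indicator (- V) (\<omega> (Suc i)) * indicator {\<omega>. \<forall>j\<le>i. \<omega> j \<in> V} \<omega> \<partial>?W) = 0"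
    proof (subst nn_integral_walk_step)
      show "(\<integral>\<^sup>+\<omega>. (\<integral>\<^sup>+x. indicator (- V) x \<partial>pmf_of_set (neighbours V E (\<omega> i))) *
          indicator {\<omega>. \<forall>j\<le>i. \<omega> j \<in> V} \<omega> \<partial>?W) = 0"
      proof (rule nn_integral_zero', rule AE_I2)
        fix \<omega>
        show "(\<integral>\<^sup>+x. indicator (- V) x \<partial>pmf_of_set (neighbours V E (\<omega> i))) *
            indicator {\<omega>. \<forall>j\<le>i. \<omega> j \<in> V} \<omega> = 0"
          using *[of "\<omega> i"] by (cases "\<omega> i \<in> V") (auto simp: indicator_def simp del: nn_integral_indicator)
      qed
    qed
    then have "AE \<omega> in ?W. indicator (- V) (\<omega> (Suc i)) * indicator {\<omega>. \<forall>j\<le>i. \<omega> j \<in> V} \<omega> = (0::ennreal)"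
      by (subst (asm) nn_integral_0_iff_AE)
         (auto intro!: borel_measurable_times_ennreal measurable_walk_coordinate borel_measurable_indicator sets_walk_stays)
    with Suc show ?case
      by eventually_elim (auto simp: indicator_def of_bool_def le_Suc_eq split: if_splits)
  qed
  then have "AE \<omega> in ?W. \<forall>i. \<forall>j\<le>i. \<omega> j \<in> V" by (simp add: AE_all_countable)
  with AE_walk_start show ?thesis by eventually_elim auto
qed

section \<open>Expected hitting times\<close>

text \<open>By the tail-sum formula the series is the expected hitting time of \<open>v\<close>. Its
  convergence is derived, not presupposed: telescoping bounds the partial sums by
  \<open>h r\<close>, so the probabilities of not having hit \<open>v\<close> tend to 0, and since
  \<open>h\<close> is bounded on the finite set \<open>V\<close>, so does the remainder
  \<open>R\<close>.\<close>

lemma suminf_emeasure_not_hit: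
  fixes V :: "'a set" and h :: "'a \<Rightarrow> real"
  assumes V: "finite V" "\<And>x. x \<in> V \<Longrightarrow> neighbours V E x \<noteq> {}" and r: "r \<in> V" and v: "h v = 0"
    and h_nonneg: "\<And>x. x \<in> V \<Longrightarrow> 0 \<le> h x"
    and h_average: "\<And>x. x \<in> V \<Longrightarrow> x \<noteq> v \<Longrightarrow>
      (\<Sum>y\<in>neighbours V E x. h y) / card (neighbours V E x) = h x - 1"
  shows "(\<Sum>i. emeasure (simple_random_walk V E r) {\<omega>. v \<notin> \<omega> ` {..i}}) = ennreal (h r)"
proof -
  let ?W = "simple_random_walk V E r"
  interpret W: prob_space ?W by (rule prob_space_simple_random_walk)
  \<comment> \<open>Almost surely \<open>A i\<close> just says that \<open>v\<close> has not been
    hit by time \<open>i\<close>. Building \<open>V\<close> into it makes the averaging equation and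
    the bound on \<open>h\<close> available pointwise on \<open>A i\<close>.\<close>
  define A :: "nat \<Rightarrow> (nat \<Rightarrow> 'a) set" where "A i = {\<omega>. \<forall>j\<le>i. \<omega> j \<in> V - {v}}" for i
  define R where "R i = (\<integral>\<^sup>+\<omega>. ennreal (h (\<omega> i)) * indicator (A i) \<omega> \<partial>?W)" for i
  have [measurable]: "A i \<in> sets ?W" for i
    unfolding A_def by (rule sets_walk_stays)
  have [measurable]: "(\<lambda>\<omega>. f (\<omega> i)) \<in> borel_measurable ?W" for f :: "'a \<Rightarrow> ennreal" and i
    by (rule measurable_walk_coordinate) simp
  have AE_V: "AE \<omega> in ?W. \<omega> 0 = r \<and> range \<omega> \<subseteq> V" using V r by (rule AE_walk_in)
  have eq_A: "emeasure ?W {\<omega>. v \<notin> \<omega> ` {..i}} = emeasure ?W (A i)" for i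
  proof (rule emeasure_eq_AE)
    show "AE \<omega> in ?W. \<omega> \<in> {\<omega>. v \<notin> \<omega> ` {..i}} \<longleftrightarrow> \<omega> \<in> A i"
      using AE_V by eventually_elim (auto simp: A_def)
    have "{\<omega>. \<forall>j\<le>i. \<omega> j \<in> - {v}} \<in> sets ?W" by (rule sets_walk_stays)
    then show "{\<omega>. v \<notin> \<omega> ` {..i}} \<in> sets ?W"
      by (rule back_subst[of "\<lambda>S. S \<in> sets ?W"]) auto
  qed fact
  have average: "(\<integral>\<^sup>+y. ennreal (h y) \<partial>pmf_of_set (neighbours V E x)) + 1 = ennreal (h x)"
    if x: "x \<in> V" "x \<noteq> v" for x
  proof -
    let ?N = "neighbours V E x"
    have N: "?N \<subseteq> V" by (auto simp: neighbours_def)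
    then have fin: "finite ?N" using V(1) by (rule finite_subset)
    have nonneg: "0 \<le> (\<Sum>y\<in>?N. h y) / card ?N"
      using N h_nonneg by (intro divide_nonneg_nonneg sum_nonneg) auto
    have "(\<integral>\<^sup>+y. ennreal (h y) \<partial>pmf_of_set ?N) = ennreal ((\<Sum>y\<in>?N. h y) / card ?N)"
    proof -
      have "(\<Sum>y\<in>?N. ennreal (h y)) = ennreal (\<Sum>y\<in>?N. h y)"
        using N h_nonneg by (intro sum_ennreal) auto
      moreover have "0 \<le> (\<Sum>y\<in>?N. h y)" "0 < card ?N"
        using N h_nonneg V(2)[OF x(1)] fin by (auto intro!: sum_nonneg simp: card_gt_0_iff)
      ultimately show ?thesis
        using V(2)[OF x(1)] fin
        by (simp add: nn_integral_pmf_of_set ennreal_of_nat_eq_real_of_nat divide_ennreal)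
    qed
    then show ?thesis
      using nonneg h_average[OF x] by (simp add: ennreal_plus[symmetric] flip: ennreal_1 del: ennreal_plus)
  qed
  \<comment> \<open>Stated additively because subtraction on \<open>ennreal\<close> is
    truncated.\<close>
  have R_Suc: "R (Suc i) + emeasure ?W (A i) = R i" for i
  proof -
    \<comment> \<open>Up to a null set, \<open>A i\<close> and \<open>A (Suc i)\<close> differ only
      where the walk is at \<open>v\<close> at time \<open>Suc i\<close>, and there \<open>h\<close>
      vanishes. Conditioning then concerns the past alone.\<close>
    have "R (Suc i) = (\<integral>\<^sup>+\<omega>. ennreal (h (\<omega> (Suc i))) * indicator (A i) \<omega> \<partial>?W)"
      unfolding R_def
    proof (rule nn_integral_cong_AE)
      show "AE \<omega> in ?W. ennreal (h (\<omega> (Suc i))) * indicator (A (Suc i)) \<omega>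
          = ennreal (h (\<omega> (Suc i))) * indicator (A i) \<omega>"
        using AE_V
      proof eventually_elim
        case (elim \<omega>)
        then show ?case
          using v by (cases "\<omega> (Suc i) = v") (auto simp: A_def indicator_def of_bool_def le_Suc_eq)
      qed
    qed
    also have "\<dots> = (\<integral>\<^sup>+\<omega>. (\<integral>\<^sup>+y. ennreal (h y) \<partial>pmf_of_set (neighbours V E (\<omega> i))) * indicator (A i) \<omega> \<partial>?W)"
      unfolding A_def by (rule nn_integral_walk_step)
    also have "\<dots> + emeasure ?W (A i) =
        (\<integral>\<^sup>+\<omega>. (\<integral>\<^sup>+y. ennreal (h y) \<partial>pmf_of_set (neighbours V E (\<omega> i))) * indicator (A i) \<omega> + indicator (A i) \<omega> \<partial>?W)"
      by (subst nn_integral_add) auto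
    also have "\<dots> = R i"
      unfolding R_def
    proof (rule nn_integral_cong)
      fix \<omega>
      show "(\<integral>\<^sup>+y. ennreal (h y) \<partial>pmf_of_set (neighbours V E (\<omega> i))) * indicator (A i) \<omega> + indicator (A i) \<omega>
          = ennreal (h (\<omega> i)) * indicator (A i) \<omega>"
        using average[of "\<omega> i"] by (auto simp: A_def indicator_def)
    qed
    finally show ?thesis .
  qed
  have R_0: "R 0 = ennreal (h r)"
  proof -
    have "R 0 = (\<integral>\<^sup>+\<omega>. ennreal (h (\<omega> 0)) \<partial>?W)"
      unfolding R_def
    proof (rule nn_integral_cong_AE)
      show "AE \<omega> in ?W. ennreal (h (\<omega> 0)) * indicator (A 0) \<omega> = ennreal (h (\<omega> 0))"
        using AE_V
      proof eventually_elim
        case (elim \<omega>)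
        then show ?case
          using v r by (cases "\<omega> 0 = v") (auto simp: A_def indicator_def)
      qed
    qed
    also have "\<dots> = ennreal (h r)" by (rule nn_integral_walk_start)
    finally show ?thesis .
  qed
  have partial: "(\<Sum>i<N. emeasure ?W (A i)) + R N = ennreal (h r)" for N
  proof (induction N)
    case (Suc N)
    then show ?case using R_Suc[of N, symmetric] by (simp add: ac_simps)
  qed (simp add: R_0)
  have partial_sums: "(\<lambda>N. \<Sum>i<N. emeasure ?W (A i)) \<longlonglongrightarrow> (\<Sum>i. emeasure ?W (A i))"
    by (rule summable_LIMSEQ) simp
  have "(\<Sum>i. emeasure ?W (A i)) \<le> ennreal (h r)"
    by (rule LIMSEQ_le_const2[OF partial_sums]) (metis partial le_iff_add)
  then have "(\<Sum>i. emeasure ?W (A i)) \<noteq> \<infinity>"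
    using ennreal_less_top order_le_less_trans by (fastforce simp: top_unique)
  \<comment> \<open>In real form the series is summable, so its terms tend to 0.\<close>
  then have "(\<Sum>i. ennreal (measure ?W (A i))) \<noteq> \<infinity>"
    by (simp add: W.emeasure_eq_measure)
  then have "summable (\<lambda>i. measure ?W (A i))"
    by (intro summable_suminf_not_top) auto
  then have "(\<lambda>i. measure ?W (A i)) \<longlonglongrightarrow> 0" by (rule summable_LIMSEQ_zero)
  define B where "B = Max (h ` V)"
  have B: "h x \<le> B" if "x \<in> V" for x using V(1) that by (simp add: B_def)
  have R_le: "R i \<le> ennreal (B * measure ?W (A i))" for i
  proof -
    have "R i \<le> (\<integral>\<^sup>+\<omega>. ennreal B * indicator (A i) \<omega> \<partial>?W)"
      unfolding R_def by (rule nn_integral_mono) (auto simp: A_def indicator_def intro!: ennreal_leI B)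
    also have "\<dots> = ennreal (B * measure ?W (A i))"
      using B[OF r] h_nonneg[OF r] by (simp add: nn_integral_cmult_indicator W.emeasure_eq_measure ennreal_mult')
    finally show ?thesis .
  qed
  have "(\<lambda>i. ennreal (B * measure ?W (A i))) \<longlonglongrightarrow> ennreal (B * 0)"
    by (intro tendsto_ennrealI tendsto_mult tendsto_const) fact
  then have upper: "(\<lambda>i. ennreal (B * measure ?W (A i))) \<longlonglongrightarrow> 0" by simp
  have "R \<longlonglongrightarrow> 0"
    by (rule tendsto_sandwich[OF _ _ tendsto_const upper])
       (rule always_eventually, rule allI, rule zero_le, rule always_eventually, rule allI, rule R_le)
  from tendsto_add[OF partial_sums this]
  have "(\<lambda>N. ennreal (h r)) \<longlonglongrightarrow> (\<Sum>i. emeasure ?W (A i))"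
    by (simp add: partial)
  then show ?thesis
    by (simp add: eq_A LIMSEQ_const_iff)
qed

section \<open>Cover cost as a sum of hitting times\<close>

lemma tour_cost_eq_suminf_unvisited:
  assumes V: "finite V" "1 < card V" and \<omega>: "\<omega> 0 = r" "range \<omega> \<subseteq> V"
  shows "tour_cost V r \<omega> = (\<Sum>i. ennreal (real (card (V - \<omega> ` {..i})) / (real (card V) - 1)))"
proof -
  let ?f = "\<lambda>i. if 1 \<le> i \<and> enat i \<le> cover_time V \<omega> then ennreal (step_cost V r \<omega> i) else 0"
  \<comment> \<open>Step \<open>Suc i\<close> is charged for what is unvisited after times
    \<open>0\<close> to \<open>i\<close>, hence the index shift; \<open>?f 0 = 0\<close>, so the
    shift loses nothing.\<close>
  have "?f (Suc i) = ennreal (real (card (V - \<omega> ` {..i})) / (real (card V) - 1))" for i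
  proof (cases "enat (Suc i) \<le> cover_time V \<omega>")
    case True
    have sub: "\<omega> ` {..i} \<subseteq> V" using \<omega>(2) by auto
    then have fin: "finite (\<omega> ` {..i})" and le: "card (\<omega> ` {..i}) \<le> card V"
      using V(1) by (auto intro: card_mono)
    have r: "r \<in> \<omega> ` {..i}" using \<omega>(1) by auto
    with fin have pos: "0 < card (\<omega> ` {..i})" by (auto simp: card_gt_0_iff)
    have "real (card (\<omega> ` {..i} - {r})) = real (card (\<omega> ` {..i})) - 1"
      using r pos by (simp add: card_Diff_singleton of_nat_diff)
    moreover have "real (card (V - \<omega> ` {..i})) = real (card V) - real (card (\<omega> ` {..i}))"
      using sub fin le by (simp add: card_Diff_subset of_nat_diff)
    ultimately show ?thesis
      using True V(2) by (simp add: step_cost_def lessThan_Suc_atMost field_simps)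
  next
    case False
    then obtain t where t: "V \<subseteq> \<omega> ` {..t}" "t < Suc i"
      by (auto simp: cover_time_def not_le INF_less_iff)
    then have "\<omega> ` {..t} \<subseteq> \<omega> ` {..i}" by auto
    with t have empty: "V - \<omega> ` {..i} = {}" by blast
    show ?thesis using False unfolding empty by simp
  qed
  then have "(\<lambda>i. ?f (Suc i)) sums (\<Sum>i. ennreal (real (card (V - \<omega> ` {..i})) / (real (card V) - 1)))"
    by (simp add: summable_sums)
  from sums_Suc[OF this] show ?thesis
    unfolding tour_cost_def by (simp add: sums_iff)
qed

text \<open>The number of unvisited vertices is a sum of indicators over \<open>v\<close>; by
  nonnegativity the integral, the series and the finite sum may be interchanged. What remains for
  each \<open>v\<close> is a tail sum, which \<open>suminf_emeasure_not_hit\<close> evaluates with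
  \<open>h\<close> the function \<open>\<lambda>x. H x v\<close>.\<close>

lemma cover_cost_eq_sum_hitting_times:
  fixes V :: "'a set" and H :: "'a \<Rightarrow> 'a \<Rightarrow> real"
  assumes V: "finite V" "1 < card V" "\<And>x. x \<in> V \<Longrightarrow> neighbours V E x \<noteq> {}" and r: "r \<in> V"
    and H_diag: "\<And>v. v \<in> V \<Longrightarrow> H v v = 0"
    and H_nonneg: "\<And>x v. x \<in> V \<Longrightarrow> v \<in> V \<Longrightarrow> 0 \<le> H x v"
    and H_average: "\<And>x v. x \<in> V \<Longrightarrow> v \<in> V \<Longrightarrow> x \<noteq> v \<Longrightarrow>
      (\<Sum>y\<in>neighbours V E x. H y v) / card (neighbours V E x) = H x v - 1"
  shows "cover_cost V E r = ennreal ((\<Sum>v\<in>V. H r v) / (real (card V) - 1))"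
proof -
  let ?W = "simple_random_walk V E r" and ?c = "1 / (real (card V) - 1)"
  define U :: "'a \<Rightarrow> nat \<Rightarrow> (nat \<Rightarrow> 'a) set" where "U v i = {\<omega>. v \<notin> \<omega> ` {..i}}" for v i
  have [measurable]: "U v i \<in> sets ?W" for v i
  proof -
    have "{\<omega>. \<forall>j\<le>i. \<omega> j \<in> - {v}} \<in> sets ?W" by (rule sets_walk_stays)
    then show ?thesis by (rule back_subst[of "\<lambda>S. S \<in> sets ?W"]) (auto simp: U_def)
  qed
  have c: "0 \<le> ?c" using V(2) by simp
  have card_eq: "ennreal (real (card (V - \<omega> ` {..i})) / (real (card V) - 1)) =
      ennreal ?c * (\<Sum>v\<in>V. indicator (U v i) \<omega>)" for \<omega> :: "nat \<Rightarrow> 'a" and i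
  proof -
    have "(\<Sum>v\<in>V. indicator (U v i) \<omega> :: ennreal) = (\<Sum>v\<in>V. indicator (V - \<omega> ` {..i}) v)"
      by (rule sum.cong) (auto simp: U_def indicator_def)
    also have "\<dots> = ennreal (real (card (V - \<omega> ` {..i})))"
    proof -
      have "(\<Sum>v\<in>V. indicator (V - \<omega> ` {..i}) v :: ennreal) = (\<Sum>v\<in>V - \<omega> ` {..i}. 1)"
        using V(1) by (intro sum.mono_neutral_cong_right) (auto simp: indicator_def)
      then show ?thesis by (simp add: ennreal_of_nat_eq_real_of_nat)
    qed
    finally show ?thesis
      using c by (simp flip: ennreal_mult)
  qed
  have AE_V: "AE \<omega> in ?W. \<omega> 0 = r \<and> range \<omega> \<subseteq> V" using V(1,3) r by (rule AE_walk_in)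
  have "cover_cost V E r = (\<integral>\<^sup>+\<omega>. (\<Sum>i. ennreal ?c * (\<Sum>v\<in>V. indicator (U v i) \<omega>)) \<partial>?W)"
    unfolding cover_cost_def
  proof (rule nn_integral_cong_AE)
    show "AE \<omega> in ?W. tour_cost V r \<omega> = (\<Sum>i. ennreal ?c * (\<Sum>v\<in>V. indicator (U v i) \<omega>))"
      using AE_V by eventually_elim (simp only: tour_cost_eq_suminf_unvisited[OF V(1,2)] card_eq)
  qed
  also have "\<dots> = (\<Sum>i. \<integral>\<^sup>+\<omega>. ennreal ?c * (\<Sum>v\<in>V. indicator (U v i) \<omega>) \<partial>?W)"
    by (rule nn_integral_suminf) measurable
  also have "\<dots> = (\<Sum>i. ennreal ?c * (\<Sum>v\<in>V. emeasure ?W (U v i)))"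
    by (subst nn_integral_cmult; simp add: nn_integral_sum)
  also have "\<dots> = ennreal ?c * (\<Sum>i. \<Sum>v\<in>V. emeasure ?W (U v i))"
    by (rule ennreal_suminf_cmult)
  also have "(\<Sum>i. \<Sum>v\<in>V. emeasure ?W (U v i)) = (\<Sum>v\<in>V. \<Sum>i. emeasure ?W (U v i))"
    by (rule suminf_sum) simp
  also have "(\<Sum>v\<in>V. \<Sum>i. emeasure ?W (U v i)) = (\<Sum>v\<in>V. ennreal (H r v))"
  proof (rule sum.cong)
    fix v assume v: "v \<in> V"
    show "(\<Sum>i. emeasure ?W (U v i)) = ennreal (H r v)"
      unfolding U_def
      by (rule suminf_emeasure_not_hit[where h="\<lambda>x. H x v"])
         (simp_all add: V r v H_diag H_nonneg H_average)
  qed simp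
  also have "ennreal ?c * \<dots> = ennreal ((\<Sum>v\<in>V. H r v) / (real (card V) - 1))"
  proof -
    have "(\<Sum>v\<in>V. ennreal (H r v)) = ennreal (\<Sum>v\<in>V. H r v)" "0 \<le> (\<Sum>v\<in>V. H r v)"
      using H_nonneg[OF r] by (auto intro: sum_ennreal sum_nonneg)
    then show ?thesis using c by (simp flip: ennreal_mult)
  qed
  finally show ?thesis .
qed

section \<open>Hitting times on the path\<close>

lemma neighbours_path:
  assumes "x \<le> n"
  shows "neighbours (path_vertices n) (path_edges n) x =
    (if x = 0 then {} else {x - 1}) \<union> (if x = n then {} else {x + 1})"
  using assms
proof -
  have "{x, w} \<in> path_edges n \<longleftrightarrow> (w = x + 1 \<and> x < n) \<or> (x = w + 1 \<and> w < n)" for w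
    by (auto simp: path_edges_def doubleton_eq_iff)
  then have "neighbours (path_vertices n) (path_edges n) x =
      {w \<in> {0..n}. (w = x + 1 \<and> x < n) \<or> (x = w + 1 \<and> w < n)}"
    by (simp only: neighbours_def path_vertices_def)
  also have "\<dots> = (if x = 0 then {} else {x - 1}) \<union> (if x = n then {} else {x + 1})"
    using assms by (intro set_eqI) (simp, presburger)
  finally show ?thesis .
qed

text \<open>The last summand vanishes for \<open>x \<le> v\<close> because natural subtraction is truncated; for
  \<open>x > v\<close> the value is \<open>(n - v)\<^sup>2 - (n - x)\<^sup>2\<close>, the mirror image of \<open>v\<^sup>2 - x\<^sup>2\<close>.\<close>

definition path_hitting_time :: "nat \<Rightarrow> nat \<Rightarrow> nat \<Rightarrow> real" where
  "path_hitting_time n x v = (real v)\<^sup>2 - (real x)\<^sup>2 + 2 * real n * real (x - v)"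

lemma path_hitting_time_nonneg:
  assumes "x \<le> n" "v \<le> n"
  shows "0 \<le> path_hitting_time n x v"
proof (cases "x \<le> v")
  case True
  then show ?thesis by (simp add: path_hitting_time_def power_mono)
next
  case False
  have "path_hitting_time n x v = (real x - real v) * ((real n - real x) + (real n - real v))"
    using False by (simp add: path_hitting_time_def power2_eq_square algebra_simps)
  also have "\<dots> \<ge> 0" using False assms by (intro mult_nonneg_nonneg add_nonneg_nonneg) auto
  finally show ?thesis .
qed

text \<open>In the interior, averaging \<open>- x^2\<close> over both neighbours lowers it by 1,
  while the term with \<open>x - v\<close> bends only at the excluded point \<open>x = v\<close>.
  The factor \<open>2 * real n\<close> is what makes the drop equal to 1 at the reflecting end
  \<open>n\<close>.\<close>

lemma path_hitting_time_average:
  assumes "x \<le> n" "v \<le> n" "x \<noteq> v"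
  shows "(\<Sum>y\<in>neighbours (path_vertices n) (path_edges n) x. path_hitting_time n y v) /
      card (neighbours (path_vertices n) (path_edges n) x) = path_hitting_time n x v - 1"
proof -
  consider "x = 0" "0 < n" | "x = n" "0 < n" | "0 < x" "x < n" using assms by linarith
  then show ?thesis
  proof cases
    case 1
    then show ?thesis
      using assms by (simp add: neighbours_path path_hitting_time_def)
  next
    case 2
    then show ?thesis
      using assms by (simp add: neighbours_path path_hitting_time_def power2_eq_square algebra_simps)
  next
    case 3
    then obtain m where m: "x = Suc m" by (cases x) auto
    \<comment> \<open>As \<open>x \<noteq> v\<close>, the points \<open>x - 1\<close>,
      \<open>x\<close> and \<open>x + 1\<close> lie weakly on one side of \<open>v\<close>, where
      truncated subtraction of \<open>v\<close> is affine.\<close>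
    have "real (Suc (Suc m) - v) + real (m - v) = 2 * real (Suc m - v)"
      using assms m by (cases "v \<le> m") auto
    then have "real n * real (Suc (Suc m) - v) = real n * (2 * real (Suc m - v) - real (m - v))"
      by simp
    then have "path_hitting_time n m v + path_hitting_time n (Suc (Suc m)) v =
        2 * (path_hitting_time n x v - 1)"
      by (simp add: m path_hitting_time_def power2_eq_square algebra_simps)
    then show ?thesis
      using 3 m by (simp add: neighbours_path)
  qed
qed

text \<open>The dependence on \<open>r\<close> is \<open>- (n + 1) r^2\<close> from the squares plus
  \<open>n r (r + 1)\<close> from the truncated differences, which leaves
  \<open>r (n - r)\<close>.\<close>

lemma sum_path_hitting_time:
  assumes "r \<le> n"
  shows "(\<Sum>v=0..n. path_hitting_time n r v) =
    real n * (real n + 1) * (2 * real n + 1) / 6 + real r * (real n - real r)"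
proof -
  have squares: "(\<Sum>v=0..n. (real v)\<^sup>2) = real n * (real n + 1) * (2 * real n + 1) / 6"
    by (induction n) (simp_all add: field_simps power2_eq_square)
  have triangle: "(\<Sum>v=0..n. real (r - v)) = real r * (real r + 1) / 2"
  proof -
    have "(\<Sum>v=0..n. real (r - v)) = (\<Sum>v=0..r. real (r - v))"
      using assms by (intro sum.mono_neutral_right) auto
    also have "\<dots> = (\<Sum>v=0..r. real v)"
      by (rule sum.reindex_bij_witness[where i="\<lambda>v. r - v" and j="\<lambda>v. r - v"]) auto
    also have "\<dots> = real r * (real r + 1) / 2"
      by (induction r) (simp_all add: field_simps)
    finally show ?thesis .
  qed
  show ?thesis
    unfolding path_hitting_time_def sum.distrib sum_subtractf sum_distrib_left[symmetric] squares triangle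
    by (simp add: field_simps power2_eq_square)
qed

lemma cover_cost_path:
  assumes "0 < n" "r \<le> n"
  shows "cover_cost (path_vertices n) (path_edges n) r =
    ennreal ((real n + 1) * (2 * real n + 1) / 6 + real r * (real n - real r) / real n)"
proof -
  have "cover_cost (path_vertices n) (path_edges n) r =
      ennreal ((\<Sum>v\<in>path_vertices n. path_hitting_time n r v) / (real (card (path_vertices n)) - 1))"
  proof (rule cover_cost_eq_sum_hitting_times)
    show "neighbours (path_vertices n) (path_edges n) x \<noteq> {}" if "x \<in> path_vertices n" for x
      using neighbours_path[of x n] that assms(1) by (auto simp: path_vertices_def)
    show "path_hitting_time n v v = 0" for v
      by (simp add: path_hitting_time_def)
  qed (use assms in \<open>auto simp: path_vertices_def path_hitting_time_nonneg
      path_hitting_time_average[unfolded path_vertices_def]\<close>)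
  also have "\<dots> = ennreal ((real n + 1) * (2 * real n + 1) / 6 + real r * (real n - real r) / real n)"
    using assms by (simp add: path_vertices_def sum_path_hitting_time add_divide_distrib)
  finally show ?thesis .
qed

theorem theorem2:
  fixes n :: nat and cc :: "nat \<Rightarrow> ennreal"
  defines "cc \<equiv> cover_cost (path_vertices n) (path_edges n)"
  assumes "n \<ge> 2" and "even n"
  shows "(\<forall>r\<in>path_vertices n. cc r < \<infinity>) \<and>
    is_arg_min cc (\<lambda>r. r \<in> path_vertices n) 0 \<and>
    is_arg_min cc (\<lambda>r. r \<in> path_vertices n) n \<and>
    is_arg_max cc (\<lambda>r. r \<in> path_vertices n) (n div 2) \<and>
    enn2real (cc (n div 2)) - enn2real (cc 0) = real n / 4"
proof -
  define q where "q r = (real n + 1) * (2 * real n + 1) / 6 + real r * (real n - real r) / real n" for r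
  have cc: "cc r = ennreal (q r)" if "r \<le> n" for r
    using assms that by (simp add: cover_cost_path q_def)
  have q0: "q 0 \<le> q r" if "r \<le> n" for r
    using that by (simp add: q_def)
  \<comment> \<open>Evenness makes the vertex \<open>n div 2\<close> the exact midpoint, where the
    parabola \<open>r (n - r)\<close> peaks.\<close>
  have half: "real (n div 2) = real n / 2" using \<open>even n\<close> by (simp add: real_of_nat_div)
  \<comment> \<open>This is \<open>(r - n/2)^2 \<ge> 0\<close> rearranged.\<close>
  have "real r * (real n - real r) \<le> real n / 2 * (real n / 2)" for r
    using zero_le_power2[of "real r - real n / 2"] by (simp add: power2_eq_square algebra_simps)
  then have "real r * (real n - real r) / real n \<le> real n / 2 * (real n / 2) / real n" for r
    by (rule divide_right_mono) simp
  then have q_half: "q r \<le> q (n div 2)" for r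
    unfolding q_def half by simp
  \<comment> \<open>Nonnegativity lets \<open>enn2real\<close> recover \<open>q r\<close> from
    \<open>ennreal (q r)\<close> in the final difference.\<close>
  have nonneg: "0 \<le> q r" if "r \<le> n" for r
    using that by (simp add: q_def)
  have "q n = q 0" by (simp add: q_def)
  moreover have "q (n div 2) - q 0 = real n / 4"
    using assms(2) unfolding q_def half by simp
  ultimately show ?thesis
    using q0 q_half nonneg
    by (auto simp: is_arg_min_def is_arg_max_def path_vertices_def cc not_less ennreal_leI)
qed

end
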